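(* Let $d>4$ be an integer and let $Z_d=\{z\in\mathbb{C} : z^d=1\}$. Then there are no subsets $A,B\subseteq\mathbb{C}$, neither of which is a singleton, such that $Z_d=A+B$.
   Context: For $A,B\subseteq\mathbb{C}$, $A+B=\{a+b : a\in A,\ b\in B\}$. *)

theory Defs
  imports Complex_Main "HOL-Library.Set_Algebras"
begin

end

theory Submission
  imports Defs
begin

text \<open>If \<open>a \<noteq> a'\<close> lie in \<open>A\<close>, then each \<open>b \<in> B\<close> yields a chord of the unit circle from
  \<open>a' + b\<close> to \<open>a + b\<close> with the fixed nonzero difference \<open>a - a'\<close>. There are at most two such
  chords, so \<open>card B \<le> 2\<close>; by symmetry \<open>card A \<le> 2\<close>, whence \<open>A + B\<close> has at most four elements.\<close>

text \<open>Conjugation inverts unit complex numbers, so conjugating \<open>diff\<close> and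
  cancelling \<open>u - v\<close> yields \<open>u' * v' = u * v\<close>.\<close>

lemma unit_chord_cases:
  fixes u v u' v' :: complex
  assumes unit: "norm u = 1" "norm v = 1" "norm u' = 1" "norm v' = 1"
    and diff: "u - v = u' - v'" and "u \<noteq> v"
  shows "u' = u \<or> u' = - v"
proof -
  have nz: "u \<noteq> 0" "v \<noteq> 0" "u' \<noteq> 0" "v' \<noteq> 0"
    using unit by auto
  have cnj: "cnj z = 1 / z" if "norm z = 1" for z
    using that by (simp add: divide_conv_cnj)
  have "1 / u - 1 / v = 1 / u' - 1 / v'"
    using arg_cong[OF diff, of cnj] unit by (simp only: complex_cnj_diff cnj)
  then have "(u - v) * (u' * v') = (u' - v') * (u * v)"
    using nz by (simp add: field_simps)
  then have prod: "u' * v' = u * v"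
    using \<open>u \<noteq> v\<close> unfolding diff[symmetric] by simp
  \<comment> \<open>The pairs \<open>u, - v\<close> and \<open>u', - v'\<close> now have the same sum and the same product.\<close>
  have v': "v' = u' - u + v"
    using diff by (simp add: algebra_simps)
  have "(u' - u) * (u' + v) = u' * v' - u * v"
    unfolding v' by (simp add: algebra_simps)
  with prod have "(u' - u) * (u' + v) = 0"
    by simp
  then show ?thesis
    by (auto simp: add_eq_0_iff2)
qed

text \<open>Finiteness is part of the claim because \<open>card\<close> is 0 on infinite
  sets.\<close>

lemma card_summand_unit_circle_le:
  fixes A B :: "complex set"
  assumes unit_circle: "A + B \<subseteq> {z. norm z = 1}" and A: "a \<in> A" "a' \<in> A" "a \<noteq> a'"
  shows "finite B \<and> card B \<le> 2"
proof (cases "B = {}")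
  case False
  then obtain b where b: "b \<in> B"
    by blast
  have unit: "norm (x + y) = 1" if "x \<in> A" "y \<in> B" for x y
    using unit_circle set_plus_intro[OF that] by blast
  \<comment> \<open>The second element solves \<open>a + c = - (a' + b)\<close>: the chord of
    \<open>c\<close> is then that of \<open>b\<close> reflected in the origin.\<close>
  have sub: "B \<subseteq> {b, - (a' + b) - a}"
  proof
    fix c assume "c \<in> B"
    then have "a + c = a + b \<or> a + c = - (a' + b)"
      using A b unit by (intro unit_chord_cases[of _ _ _ "a' + c"]) auto
    then show "c \<in> {b, - (a' + b) - a}"
      by (auto simp: algebra_simps)
  qed
  have "card B \<le> card {b, - (a' + b) - a}"
    using sub by (intro card_mono) auto
  also have "\<dots> \<le> 2"
    by (simp add: card_insert_if)
  finally show ?thesis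
    using finite_subset[OF sub] by simp
qed simp

theorem theorem1p1:
  fixes d :: nat
  assumes "d > 4"
  shows "\<not> (\<exists>A B :: complex set. \<not> is_singleton A \<and> \<not> is_singleton B \<and>
           {z :: complex. z ^ d = 1} = A + B)"
proof
  assume "\<exists>A B :: complex set. \<not> is_singleton A \<and> \<not> is_singleton B \<and>
           {z :: complex. z ^ d = 1} = A + B"
  then obtain A B :: "complex set" where ns: "\<not> is_singleton A" "\<not> is_singleton B"
    and eq: "{z :: complex. z ^ d = 1} = A + B"
    by blast
  \<comment> \<open>Empty sets are not singletons either, so they are excluded first.\<close>
  have "1 \<in> A + B"
    unfolding eq[symmetric] by simp
  then have "A \<noteq> {}" "B \<noteq> {}"
    by (auto elim: set_plus_elim)
  with ns obtain a a' b b' where A: "a \<in> A" "a' \<in> A" "a \<noteq> a'" and B: "b \<in> B" "b' \<in> B" "b \<noteq> b'"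
    by (metis is_singletonI')
  have unit_circle: "A + B \<subseteq> {z. norm z = 1}"
  proof
    fix z assume "z \<in> A + B"
    \<comment> \<open>Written with \<open>1 ^ d\<close> to use injectivity of positive powers on
      nonnegative reals.\<close>
    then have "norm z ^ d = 1 ^ d"
      unfolding eq[symmetric] by (simp flip: norm_power)
    then show "z \<in> {z. norm z = 1}"
      using \<open>d > 4\<close> power_eq_imp_eq_base[of "norm z" d 1] by simp
  qed
  have cB: "finite B" "card B \<le> 2"
    using card_summand_unit_circle_le[OF unit_circle A] by auto
  have cA: "finite A" "card A \<le> 2"
    using card_summand_unit_circle_le[of B A b b'] unit_circle B by (auto simp: add.commute)
  have "d = card (A + B)"
    using card_roots_unity_eq[of d] \<open>d > 4\<close> eq by simp
  also have "\<dots> \<le> card (A \<times> B)"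
    unfolding set_plus_image using cA cB by (intro card_image_le) auto
  also have "\<dots> \<le> 2 * 2"
    unfolding card_cartesian_product using cA cB by (intro mult_le_mono)
  finally show False
    using \<open>d > 4\<close> by simp
qed

end
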